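(* Let $n\ge1$ and $N\ge1$ be integers and $p_1,\dots,p_n>0$ real with $\sum_i p_i=1$. Let $q_{(1)}\ge q_{(2)}\ge\cdots$ be the quotients $p_i/k$ ($1\le i\le n$, $k\ge1$), listed with multiplicity in decreasing order. For every mode $m$ of the multinomial distribution with parameters $N$ and $(p_1,\dots,p_n)$, the admissible multiplier interval of $m$ is exactly $[\,1/q_{(N)},\,1/q_{(N+1)}\,]$. The following are equivalent: (i) the mode is unique; (ii) $q_{(N)}>q_{(N+1)}$; (iii) the admissible multiplier interval has nonempty interior. If these conditions hold and $m$ is the mode, then for every $\lambda\in[1/q_{(N)},1/q_{(N+1)})$ one has $m_i=\lfloor\lambda p_i\rfloor$ for $1\le i\le n$ and $\sum_i\lfloor\lambda p_i\rfloor=N$; moreover, writing $\lambda=N+d$, one has $m_i=\lfloor (N+d)p_i\rfloor$ for all $i$ with $d\in[0,n)$. If these conditions fail, no such floor form exists: there is no mode $m$ and real $\lambda>0$ with $m_i=\lfloor\lambda p_i\rfloor$ for all $i$.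
   Context: A mode is a maximiser of $P(m)=\frac{N!}{m_1!\cdots m_n!}\prod_i p_i^{m_i}$ over $m\in\mathbb Z_{\ge0}^n$ with $\sum_i m_i=N$. For a mode $m$, a real number $\lambda>0$ is called an admissible multiplier if $m_i\le\lambda p_i\le m_i+1$ for all $i$; the admissible multiplier interval is the set of all admissible multipliers, which equals $[\max_j m_j/p_j,\ \min_i(m_i+1)/p_i]$. *)

theory Defs
  imports "HOL-Analysis.Analysis"
begin

text \<open>
  The index set \<open>{1..n}\<close> with \<open>n \<ge> 1\<close> is a finite type \<open>'n\<close>; thus \<open>n = CARD('n)\<close>.
\<close>

definition multinomial_prob :: "nat \<Rightarrow> ('n::finite \<Rightarrow> real) \<Rightarrow> ('n \<Rightarrow> nat) \<Rightarrow> real" where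
  "multinomial_prob N p m = fact N / (\<Prod>i\<in>UNIV. fact (m i)) * (\<Prod>i\<in>UNIV. p i ^ m i)"

definition multinomial_mode :: "nat \<Rightarrow> ('n::finite \<Rightarrow> real) \<Rightarrow> ('n \<Rightarrow> nat) \<Rightarrow> bool" where
  "multinomial_mode N p = is_arg_max (multinomial_prob N p) (\<lambda>m. (\<Sum>i\<in>UNIV. m i) = N)"

definition admissible_multiplier :: "('n::finite \<Rightarrow> real) \<Rightarrow> ('n \<Rightarrow> nat) \<Rightarrow> real \<Rightarrow> bool" where
  "admissible_multiplier p m l \<longleftrightarrow>
     l > 0 \<and> (\<forall>i. real (m i) \<le> l * p i \<and> l * p i \<le> real (m i) + 1)"

definition admissible_interval :: "('n::finite \<Rightarrow> real) \<Rightarrow> ('n \<Rightarrow> nat) \<Rightarrow> real set" where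
  "admissible_interval p m = {l. admissible_multiplier p m l}"

text \<open>
  \<open>q 1 \<ge> q 2 \<ge> \<dots>\<close> lists all the quotients \<open>p i / k\<close>, \<open>k \<ge> 1\<close>, with multiplicity: the
  bijection \<open>s\<close> makes every pair \<open>(i, k)\<close> occur at exactly one position. The value \<open>q 0\<close> is
  irrelevant. Ties can be ordered in several ways, but the values \<open>q j\<close> with \<open>j \<ge> 1\<close> do not
  depend on this choice.
\<close>

definition decreasing_quotients :: "('n::finite \<Rightarrow> real) \<Rightarrow> (nat \<Rightarrow> real) \<Rightarrow> bool" where
  "decreasing_quotients p q \<longleftrightarrow>
     (\<exists>s. bij_betw s {1..} (UNIV \<times> {1..}) \<and>
          (\<forall>j\<ge>1. q j = p (fst (s j)) / real (snd (s j)))) \<and>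
     antimono_on {1..} q"

text \<open>Such a listing exists, and so does a mode.\<close>

lemma decreasing_quotients_exists:
  fixes p :: "'n::finite \<Rightarrow> real"
  assumes pos: "\<And>i. p i > 0"
  shows "\<exists>q. decreasing_quotients p q"
proof -
  define S :: "('n \<times> nat) set" where "S = UNIV \<times> {1..}"
  define f where "f t = p (fst t) / real (snd t)" for t :: "'n \<times> nat"
  define g :: "'n \<times> nat \<Rightarrow> nat" where "g = to_nat_on UNIV"
  have "countable (UNIV :: ('n \<times> nat) set)"
    using countable_SIGMA[of "UNIV :: 'n set" "\<lambda>_. UNIV :: nat set"]
    by (simp add: countable_finite)
  then have g: "inj g" unfolding g_def by (rule inj_on_to_nat_on)
  define before where "before t u \<longleftrightarrow> f t > f u \<or> (f t = f u \<and> g t < g u)" for t u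
  define r where "r u = card {t \<in> S. before t u}" for u
  have fin: "finite {t \<in> S. f t \<ge> c}" if c: "c > 0" for c
  proof (rule finite_subset)
    show "{t \<in> S. f t \<ge> c} \<subseteq> (SIGMA i:UNIV. {..nat \<lceil>p i / c\<rceil>})"
    proof clarsimp
      fix i k assume "(i, k) \<in> S" "c \<le> f (i, k)"
      then have "real k \<le> p i / c" using c by (auto simp: S_def f_def field_simps)
      then show "k \<le> nat \<lceil>p i / c\<rceil>" by linarith
    qed
  qed auto
  have fpos: "f u > 0" if "u \<in> S" for u
    using that pos by (auto simp: S_def f_def)
  have finb: "finite {t \<in> S. before t u}" if "u \<in> S" for u
    by (rule finite_subset[OF _ fin[OF fpos[OF that]]]) (auto simp: before_def)
  have r_less: "r t < r u" if "t \<in> S" "u \<in> S" "before t u" for t u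
    unfolding r_def
  proof (rule psubset_card_mono[OF finb[OF that(2)]])
    show "{v \<in> S. before v t} \<subset> {v \<in> S. before v u}"
      using that by (auto simp: before_def)
  qed
  have total: "before t u \<or> before u t" if "t \<noteq> u" for t u
    using that injD[OF g, of t u] by (force simp: before_def)
  have inj: "inj_on r S"
    by (rule inj_onI) (metis total r_less less_irrefl)
  have "infinite S"
    unfolding S_def by (simp add: finite_cartesian_product_iff infinite_Ici)
  then have inf: "infinite (r ` S)" using inj finite_image_iff by blast
  define e where "e = inv_into S r \<circ> enumerate (r ` S) \<circ> (\<lambda>j. j - 1)"
  have "bij_betw (\<lambda>j::nat. j - 1) {1..} UNIV"
    by (rule bij_betw_byWitness[where f' = Suc]) auto
  then have bij: "bij_betw e {1..} S"
    unfolding e_def comp_assoc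
    by (intro bij_betw_trans[OF bij_betw_trans[OF _ bij_enumerate[OF inf]]
          bij_betw_inv_into[OF inj_on_imp_bij_betw[OF inj]], unfolded comp_assoc])
  have re: "r (e j) = enumerate (r ` S) (j - 1)" for j
    unfolding e_def using enumerate_in_set[OF inf] by (simp add: f_inv_into_f)
  have "f (e k) \<le> f (e j)" if "1 \<le> j" "j \<le> k" for j k
  proof (rule ccontr)
    assume "\<not> ?thesis"
    then have "before (e k) (e j)" by (simp add: before_def)
    moreover have "e k \<in> S" "e j \<in> S" using bij that by (auto dest: bij_betwE)
    ultimately have "r (e k) < r (e j)" using r_less by blast
    then show False using inf that by (simp add: re)
  qed
  then have "decreasing_quotients p (f \<circ> e)"
    unfolding decreasing_quotients_def using bij
    by (auto simp: S_def f_def monotone_on_def)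
  then show ?thesis by blast
qed

lemma multinomial_mode_exists:
  fixes p :: "'n::finite \<Rightarrow> real"
  shows "\<exists>m. multinomial_mode N p m"
proof -
  define M where "M = {m :: 'n \<Rightarrow> nat. (\<Sum>i\<in>UNIV. m i) = N}"
  have "M \<subseteq> PiE UNIV (\<lambda>_. {..N})"
    by (auto simp: M_def intro: member_le_sum)
  then have fin: "finite M" by (rule finite_subset) (simp add: finite_PiE)
  have "(\<lambda>i. if i = undefined then N else 0) \<in> M" by (simp add: M_def)
  then have "Max (multinomial_prob N p ` M) \<in> multinomial_prob N p ` M"
    using fin by (intro Max_in) auto
  then obtain m where "m \<in> M" "multinomial_prob N p m = Max (multinomial_prob N p ` M)"
    by (metis imageE)
  then have "m \<in> M" "\<forall>y\<in>M. multinomial_prob N p y \<le> multinomial_prob N p m"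
    using fin by auto
  then show ?thesis
    unfolding multinomial_mode_def is_arg_max_def M_def by (auto simp: not_less)
qed

end

theory Submission
  imports Defs
begin

text \<open>
  The probability of \<open>m\<close> is \<open>N!\<close> times the product of the quotients \<open>p i / k\<close> with
  \<open>1 \<le> k \<le> m i\<close>. Moving one unit from one coordinate to another replaces one of these \<open>N\<close>
  quotients by an unused one, so at a mode every used quotient is at least every unused one.
  Hence the used quotients are \<open>N\<close> largest ones, their minimum is \<open>q N\<close> and the maximum of the
  unused ones is \<open>q (N + 1)\<close>, while \<open>l\<close> is admissible iff \<open>1 / l\<close> separates the two sets. If
  \<open>q N = q (N + 1)\<close>, exchanging a smallest used quotient for a largest unused one yields another
  mode.
\<close>

section \<open>Moving one unit between coordinates\<close>

lemma sum_fun_upd_Suc: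
  fixes m :: "'n::finite \<Rightarrow> nat"
  shows "(\<Sum>x\<in>UNIV. (m(i := Suc (m i))) x) = Suc (\<Sum>x\<in>UNIV. m x)"
proof -
  have "(\<Sum>x\<in>UNIV - {i}. (m(i := Suc (m i))) x) = (\<Sum>x\<in>UNIV - {i}. m x)"
    by (rule sum.cong) auto
  then show ?thesis by (simp add: sum.remove[of UNIV i])
qed

lemma multinomial_prob_fun_upd_Suc:
  fixes p :: "'n::finite \<Rightarrow> real"
  shows "multinomial_prob N p (m(i := Suc (m i))) = multinomial_prob N p m * (p i / real (Suc (m i)))"
proof -
  let ?m = "m(i := Suc (m i))"
  have "(\<Prod>x\<in>UNIV - {i}. fact (?m x)) = (\<Prod>x\<in>UNIV - {i}. fact (m x) :: real)"
    and "(\<Prod>x\<in>UNIV - {i}. p x ^ ?m x) = (\<Prod>x\<in>UNIV - {i}. p x ^ m x)"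
    by (auto intro: prod.cong)
  then show ?thesis
    by (simp add: multinomial_prob_def prod.remove[of UNIV i] field_simps del: of_nat_Suc)
qed

text \<open>Both \<open>m\<close> and \<open>m'\<close> arise from \<open>m0\<close>, which is
  \<open>m\<close> with one unit taken from \<open>j\<close>, by adding a unit. Each addition
  multiplies the probability by one quotient, so the factor for \<open>m0\<close> cancels; the
  product form of the last claim avoids ratios of probabilities.\<close>

lemma multinomial_prob_exchange:
  fixes p :: "'n::finite \<Rightarrow> real"
  assumes pos: "\<And>i. p i > 0" and ij: "i \<noteq> j" and mj: "m j > 0"
  defines "m' \<equiv> m(j := m j - 1, i := Suc (m i))"
  shows "(\<Sum>x\<in>UNIV. m' x) = (\<Sum>x\<in>UNIV. m x)"
    and "multinomial_prob N p m > 0"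
    and "multinomial_prob N p m' * (p j / real (m j)) =
         multinomial_prob N p m * (p i / real (Suc (m i)))"
proof -
  define m0 where "m0 = m(j := m j - 1)"
  have m: "m = m0(j := Suc (m0 j))" and m': "m' = m0(i := Suc (m0 i))"
    and "m0 i = m i" "Suc (m0 j) = m j"
    using ij mj by (auto simp: m0_def m'_def)
  show "(\<Sum>x\<in>UNIV. m' x) = (\<Sum>x\<in>UNIV. m x)"
    using sum_fun_upd_Suc[of m0 i] sum_fun_upd_Suc[of m0 j] m m' by metis
  show "multinomial_prob N p m > 0"
    unfolding multinomial_prob_def using pos
    by (intro mult_pos_pos divide_pos_pos prod_pos) auto
  show "multinomial_prob N p m' * (p j / real (m j)) =
      multinomial_prob N p m * (p i / real (Suc (m i)))"
    using multinomial_prob_fun_upd_Suc[of N p m0 i] multinomial_prob_fun_upd_Suc[of N p m0 j]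
      m m' \<open>m0 i = m i\<close> \<open>Suc (m0 j) = m j\<close> by (metis mult.assoc mult.commute)
qed

lemma multinomial_mode_iff:
  "multinomial_mode N p m \<longleftrightarrow> (\<Sum>i\<in>UNIV. m i) = N \<and>
     (\<forall>m'. (\<Sum>i\<in>UNIV. m' i) = N \<longrightarrow> multinomial_prob N p m' \<le> multinomial_prob N p m)"
  by (auto simp: multinomial_mode_def is_arg_max_def not_less)

lemma multinomial_mode_quotient_le:
  fixes p :: "'n::finite \<Rightarrow> real"
  assumes pos: "\<And>i. p i > 0" and mode: "multinomial_mode N p m" and mj: "m j > 0"
  shows "p i / real (Suc (m i)) \<le> p j / real (m j)"
proof (cases "i = j")
  case True
  then show ?thesis using pos[of j] mj by (auto intro!: divide_left_mono)
next
  case False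
  \<comment> \<open>If the inequality failed, moving a unit from \<open>j\<close> to
    \<open>i\<close> would raise the probability above that of the mode.\<close>
  note ex = multinomial_prob_exchange[of p i j m, OF pos False mj]
  let ?P = "multinomial_prob N p m"
  have "multinomial_prob N p (m(j := m j - 1, i := Suc (m i))) \<le> ?P"
    using mode ex(1) by (simp add: multinomial_mode_iff del: fun_upd_apply)
  then have "?P * (p i / real (Suc (m i))) \<le> ?P * (p j / real (m j))"
    unfolding ex(3)[symmetric] using pos[of j] by (intro mult_right_mono) auto
  then show ?thesis using ex(2)[of N] mult_le_cancel_left_pos by blast
qed

section \<open>Used quotients as top values of the listing\<close>

text \<open>\<open>A\<close> models the positions of the used quotients. Because of ties it may
  differ from \<open>{1..N}\<close>, so only values are compared. If it does differ, equal
  cardinality makes each set contain a position that the other lacks, and \<open>sep\<close>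
  compares across the two.\<close>

lemma antimono_on_top_segment:
  fixes q :: "nat \<Rightarrow> real"
  assumes q: "antimono_on {1..} q" and N: "card A = N" "N \<ge> 1" and A: "A \<subseteq> {1..}"
    and sep: "\<And>a k. a \<in> A \<Longrightarrow> k \<ge> 1 \<Longrightarrow> k \<notin> A \<Longrightarrow> q k \<le> q a"
  shows "\<And>a. a \<in> A \<Longrightarrow> q N \<le> q a"
    and "\<exists>a\<in>A. q a = q N"
    and "\<And>k. k \<ge> 1 \<Longrightarrow> k \<notin> A \<Longrightarrow> q k \<le> q (N + 1)"
    and "\<exists>k\<ge>1. k \<notin> A \<and> q k = q (N + 1)"
proof -
  have anti: "q k \<le> q j" if "1 \<le> j" "j \<le> k" for j k
    using monotone_onD[OF q, of j k] that by auto
  have fin: "finite A" using N card.infinite by fastforce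
  have sub: "A = {1..N}" if "A \<subseteq> {1..N} \<or> {1..N} \<subseteq> A"
    using that card_subset_eq[of "{1..N}" A] card_subset_eq[of A "{1..N}"] fin N by auto
  show 1: "q N \<le> q a" if "a \<in> A" for a
  proof (cases "a \<le> N")
    case False
    \<comment> \<open>Since \<open>a\<close> lies beyond \<open>N\<close>, some \<open>k\<close> up
      to \<open>N\<close> is missing from \<open>A\<close>, and
      \<open>q N \<le> q k \<le> q a\<close>.\<close>
    then have "\<not> {1..N} \<subseteq> A" using sub that by auto
    then obtain k where "k \<in> {1..N}" "k \<notin> A" by blast
    then show ?thesis using anti[of k N] sep[OF that, of k] by auto
  qed (use anti that A in auto)
  show 2: "q k \<le> q (N + 1)" if "k \<ge> 1" "k \<notin> A" for k
  proof (cases "k \<ge> N + 1")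
    case False
    \<comment> \<open>Dually, some \<open>a\<close> in \<open>A\<close> lies beyond
      \<open>N\<close>, and \<open>q k \<le> q a \<le> q (N + 1)\<close>.\<close>
    then have "\<not> A \<subseteq> {1..N}" using sub that by auto
    then obtain a where "a \<in> A" "a \<ge> N + 1" using A by fastforce
    then show ?thesis using anti[of "N + 1" a] sep[of a k] that by linarith
  qed (use anti in auto)
  \<comment> \<open>Such a position has value at most \<open>q N\<close>; the first claim gives the
    reverse inequality. The last claim is obtained dually from a position up to \<open>N + 1\<close>
    outside \<open>A\<close>.\<close>
  obtain a where a: "a \<in> A" "a \<ge> N"
  proof (cases "N \<in> A")
    case False
    then have "A \<noteq> {1..N}" using N(2) by auto
    then have "\<not> A \<subseteq> {1..N}" using sub by blast
    then show ?thesis using that A by fastforce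
  qed auto
  then show "\<exists>a\<in>A. q a = q N" using 1[of a] anti[of N a] N by force
  obtain k where k: "k \<ge> 1" "k \<le> N + 1" "k \<notin> A"
  proof (cases "N + 1 \<in> A")
    case True
    then have "\<not> {1..N} \<subseteq> A" using sub by auto
    then show ?thesis using that by fastforce
  qed auto
  then show "\<exists>k\<ge>1. k \<notin> A \<and> q k = q (N + 1)" using 2[of k] anti[of k "N + 1"] by force
qed

lemma multinomial_mode_quotient_bounds:
  fixes p :: "'n::finite \<Rightarrow> real"
  assumes N: "N \<ge> 1" and pos: "\<And>i. p i > 0" and q: "decreasing_quotients p q"
    and mode: "multinomial_mode N p m"
  shows "\<And>j. m j > 0 \<Longrightarrow> q N \<le> p j / real (m j)"
    and "\<exists>j. m j > 0 \<and> p j / real (m j) = q N"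
    and "\<And>i. p i / real (Suc (m i)) \<le> q (N + 1)"
    and "\<exists>i. p i / real (Suc (m i)) = q (N + 1)"
proof -
  obtain s where s: "bij_betw s {1..} (UNIV \<times> {1..})"
    and qs: "\<And>j. j \<ge> 1 \<Longrightarrow> q j = p (fst (s j)) / real (snd (s j))"
    and anti: "antimono_on {1..} q"
    using q by (auto simp: decreasing_quotients_def)
  \<comment> \<open>\<open>B\<close> holds the used pairs, as many as the sum of the
    \<open>m i\<close>, which is \<open>N\<close>; \<open>A\<close> holds their positions in the
    listing.\<close>
  define B where "B = (SIGMA i:UNIV. {1..m i})"
  define A where "A = {j \<in> {1..}. s j \<in> B}"
  have "bij_betw s A B"
    unfolding bij_betw_def
  proof
    show "inj_on s A" using s by (auto simp: A_def bij_betw_def inj_on_def)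
    have "B \<subseteq> s ` {1..}" using s by (auto simp: B_def bij_betw_def)
    then show "s ` A = B" by (auto simp: A_def)
  qed
  then have "card A = card B" by (rule bij_betw_same_card)
  also have "\<dots> = N" using mode by (simp add: B_def multinomial_mode_iff)
  finally have card: "card A = N" .
  have hit: "\<exists>j\<ge>1. s j = (i, k)" if "k \<ge> 1" for i k
  proof -
    have "(i, k) \<in> s ` {1..}" using s that by (simp add: bij_betw_def)
    then show ?thesis by (auto simp: eq_commute)
  qed
  have snd1: "snd (s j) \<ge> 1" if "j \<ge> 1" for j
    using bij_betwE[OF s] that by (auto simp: mem_Times_iff)
  have out: "p (fst (s k)) / real (snd (s k)) \<le> p (fst (s k)) / real (Suc (m (fst (s k))))"
    if "k \<ge> 1" "k \<notin> A" for k
    using that snd1[of k] pos[of "fst (s k)"]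
    by (cases "s k") (auto simp: A_def B_def intro!: divide_left_mono)
  have into: "m (fst (s a)) > 0"
    "p (fst (s a)) / real (m (fst (s a))) \<le> p (fst (s a)) / real (snd (s a))" if "a \<in> A" for a
    using that pos[of "fst (s a)"]
    by (cases "s a"; auto simp: A_def B_def intro!: divide_left_mono)+
  have sep: "q k \<le> q a" if "a \<in> A" "k \<ge> 1" "k \<notin> A" for a k
  proof -
    have "a \<ge> 1" using that by (simp add: A_def)
    then show ?thesis
      using qs[of a] qs[of k] out[of k] into[of a] that
        multinomial_mode_quotient_le[OF pos mode, of "fst (s a)" "fst (s k)"] by linarith
  qed
  have "A \<subseteq> {1..}" by (auto simp: A_def)
  note top = antimono_on_top_segment[OF anti card N this sep]
  show used: "q N \<le> p j / real (m j)" if "m j > 0" for j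
  proof -
    obtain a where a: "a \<ge> 1" "s a = (j, m j)" using hit[of "m j" j] \<open>m j > 0\<close> by auto
    then have "a \<in> A" using \<open>m j > 0\<close> by (auto simp: A_def B_def)
    then show ?thesis using top(1)[of a] qs[of a] a by simp
  qed
  show unused: "p i / real (Suc (m i)) \<le> q (N + 1)" for i
  proof -
    obtain k where k: "k \<ge> 1" "s k = (i, Suc (m i))" using hit[of "Suc (m i)" i] by auto
    then have "k \<notin> A" by (auto simp: A_def B_def)
    then show ?thesis using top(3)[of k] qs[of k] k by simp
  qed
  obtain a where a: "a \<in> A" "q a = q N" using top(2) by blast
  then have "a \<ge> 1" by (simp add: A_def)
  then have "p (fst (s a)) / real (m (fst (s a))) = q N"
    using a into[of a] qs[of a] used[of "fst (s a)"] by linarith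
  then show "\<exists>j. m j > 0 \<and> p j / real (m j) = q N" using into(1)[OF a(1)] by blast
  obtain k where k: "k \<ge> 1" "k \<notin> A" "q k = q (N + 1)" using top(4) by blast
  then have "p (fst (s k)) / real (Suc (m (fst (s k)))) = q (N + 1)"
    using out[of k] qs[of k] unused[of "fst (s k)"] by linarith
  then show "\<exists>i. p i / real (Suc (m i)) = q (N + 1)" by blast
qed

section \<open>From quotients to multipliers and floors\<close>

lemma decreasing_quotients_pos:
  assumes "decreasing_quotients p q" and "\<And>i. p i > 0" and "j \<ge> 1"
  shows "q j > 0"
proof -
  obtain s where s: "bij_betw s {1..} (UNIV \<times> {1..})"
    and qs: "\<And>j. j \<ge> 1 \<Longrightarrow> q j = p (fst (s j)) / real (snd (s j))"
    using assms(1) by (auto simp: decreasing_quotients_def)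
  have "snd (s j) \<ge> 1" using bij_betwE[OF s] \<open>j \<ge> 1\<close> by (auto simp: mem_Times_iff)
  then show ?thesis using qs[OF \<open>j \<ge> 1\<close>] assms(2) by simp
qed

text \<open>Each coordinate condition compares \<open>1 / l\<close> with a boundary quotient. The
  extreme boundary values \<open>q N\<close> and \<open>q (N + 1)\<close> are attained, so all
  coordinates together amount to one comparison, also in the strict version that the floor form
  needs.\<close>

lemma multinomial_mode_multiplier:
  fixes p :: "'n::finite \<Rightarrow> real"
  assumes N: "N \<ge> 1" and pos: "\<And>i. p i > 0" and q: "decreasing_quotients p q"
    and mode: "multinomial_mode N p m"
  shows "l > 0 \<Longrightarrow> (\<forall>i. real (m i) \<le> l * p i) \<longleftrightarrow> 1 / q N \<le> l"
    and "l > 0 \<Longrightarrow> (\<forall>i. l * p i \<le> real (m i) + 1) \<longleftrightarrow> l \<le> 1 / q (N + 1)"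
    and "l > 0 \<Longrightarrow> (\<forall>i. l * p i < real (m i) + 1) \<longleftrightarrow> l < 1 / q (N + 1)"
proof -
  note b = multinomial_mode_quotient_bounds[OF N pos q mode]
  have qpos: "q N > 0" "q (N + 1) > 0" using decreasing_quotients_pos[OF q pos] N by auto
  obtain j where j: "m j > 0" "p j / real (m j) = q N" using b(2) by blast
  obtain i where i: "p i / real (Suc (m i)) = q (N + 1)" using b(4) by blast
  assume l: "l > 0"
  have used: "real (m j) \<le> l * p j \<longleftrightarrow> 1 / l \<le> p j / real (m j)" if "m j > 0" for j
    using that l by (simp add: field_simps)
  have unused: "l * p i \<le> real (m i) + 1 \<longleftrightarrow> p i / real (Suc (m i)) \<le> 1 / l"
    "l * p i < real (m i) + 1 \<longleftrightarrow> p i / real (Suc (m i)) < 1 / l" for i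
    using l by (simp_all add: field_simps)
  have "(\<forall>i. real (m i) \<le> l * p i) \<longleftrightarrow> 1 / l \<le> q N"
  proof
    assume "\<forall>i. real (m i) \<le> l * p i"
    then show "1 / l \<le> q N" using used[OF j(1)] j(2) by simp
  next
    assume *: "1 / l \<le> q N"
    show "\<forall>i. real (m i) \<le> l * p i"
    proof
      fix i
      \<comment> \<open>If \<open>m i = 0\<close>, there is no used quotient (\<open>p i / 0\<close>
        is 0 by convention), and the claim is just \<open>0 \<le> l * p i\<close>.\<close>
      show "real (m i) \<le> l * p i"
        using used[of i] b(1)[of i] * l pos[of i] by (cases "m i > 0") auto
    qed
  qed
  then show "(\<forall>i. real (m i) \<le> l * p i) \<longleftrightarrow> 1 / q N \<le> l"
    using l qpos by (simp add: field_simps)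
  have "(\<forall>i. l * p i \<le> real (m i) + 1) \<longleftrightarrow> q (N + 1) \<le> 1 / l"
    unfolding unused using b(3) i by (metis order_trans)
  then show "(\<forall>i. l * p i \<le> real (m i) + 1) \<longleftrightarrow> l \<le> 1 / q (N + 1)"
    using l qpos by (simp add: field_simps)
  have "(\<forall>i. l * p i < real (m i) + 1) \<longleftrightarrow> q (N + 1) < 1 / l"
    unfolding unused using b(3) i by (metis order_le_less_trans)
  then show "(\<forall>i. l * p i < real (m i) + 1) \<longleftrightarrow> l < 1 / q (N + 1)"
    using l qpos by (simp add: field_simps)
qed

text \<open>The floor form is admissibility with the upper inequality strict, which removes the
  right endpoint. The interval may be empty; that case yields the nonexistence of a floor
  form.\<close>

lemma multinomial_mode_eq_floor_iff:
  fixes p :: "'n::finite \<Rightarrow> real"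
  assumes "N \<ge> 1" and "\<And>i. p i > 0" and "decreasing_quotients p q"
    and "multinomial_mode N p m" and l: "l > 0"
  shows "(\<forall>i. int (m i) = \<lfloor>l * p i\<rfloor>) \<longleftrightarrow> l \<in> {1 / q N ..< 1 / q (N + 1)}"
proof -
  have *: "int (m i) = \<lfloor>l * p i\<rfloor> \<longleftrightarrow> real (m i) \<le> l * p i \<and> l * p i < real (m i) + 1" for i
    using floor_eq_iff[of "l * p i" "int (m i)"] by auto
  show ?thesis
    unfolding * all_conj_distrib atLeastLessThan_iff
    using multinomial_mode_multiplier(1,3)[OF assms] by blast
qed

lemma multinomial_mode_not_unique:
  fixes p :: "'n::finite \<Rightarrow> real"
  assumes N: "N \<ge> 1" and pos: "\<And>i. p i > 0" and q: "decreasing_quotients p q"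
    and mode: "multinomial_mode N p m" and eq: "q N = q (N + 1)"
  shows "\<exists>m'. multinomial_mode N p m' \<and> m' \<noteq> m"
proof -
  note b = multinomial_mode_quotient_bounds[OF N pos q mode]
  obtain j where j: "m j > 0" "p j / real (m j) = q N" using b(2) by blast
  obtain i where i: "p i / real (Suc (m i)) = q (N + 1)" using b(4) by blast
  \<comment> \<open>The exchange needs distinct coordinates; for \<open>i = j\<close> the two equal
    quotients would have different denominators.\<close>
  have "i \<noteq> j"
  proof
    assume "i = j"
    then have "p j / real (m j) = p j / real (Suc (m j))" using i j eq by simp
    then show False using j(1) pos[of j] by (simp add: field_simps)
  qed
  define m' where "m' = m(j := m j - 1, i := Suc (m i))"
  note ex = multinomial_prob_exchange[of p i j m, OF pos \<open>i \<noteq> j\<close> j(1), folded m'_def]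
  have "q N > 0" using decreasing_quotients_pos[OF q pos N] .
  \<comment> \<open>Both exchange factors equal \<open>q N > 0\<close> and cancel.\<close>
  then have "multinomial_prob N p m' = multinomial_prob N p m"
    using ex(3)[of N] unfolding i j(2) eq by simp
  then have "multinomial_mode N p m'" using mode ex(1) by (simp add: multinomial_mode_iff)
  moreover have "m' i \<noteq> m i" by (simp add: m'_def)
  ultimately show ?thesis by metis
qed

text \<open>Uniqueness and nonempty interior are each linked to \<open>q N > q (N + 1)\<close>. A
  mode exists by \<open>multinomial_mode_exists\<close>, so the claims about all modes are not
  vacuous.\<close>

theorem proposition3p2:
  fixes p :: "'n::finite \<Rightarrow> real" and N :: nat and q :: "nat \<Rightarrow> real"
  assumes N: "N \<ge> 1"
    and p_pos: "\<And>i. p i > 0"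
    and p_sum: "(\<Sum>i\<in>UNIV. p i) = 1"
    and q: "decreasing_quotients p q"
  shows
    "(\<forall>m. multinomial_mode N p m \<longrightarrow>
        admissible_interval p m = {1 / q N .. 1 / q (N + 1)})
     \<and> ((\<exists>!m. multinomial_mode N p m) \<longleftrightarrow> q N > q (N + 1))
     \<and> (\<forall>m. multinomial_mode N p m \<longrightarrow>
          (q N > q (N + 1) \<longleftrightarrow> interior (admissible_interval p m) \<noteq> {}))
     \<and> (q N > q (N + 1) \<longrightarrow>
          (\<forall>m. multinomial_mode N p m \<longrightarrow>
            (\<forall>l\<in>{1 / q N ..< 1 / q (N + 1)}.
               (\<forall>i. int (m i) = \<lfloor>l * p i\<rfloor>)
             \<and> (\<Sum>i\<in>UNIV. \<lfloor>l * p i\<rfloor>) = int N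
             \<and> (\<forall>d. l = real N + d \<longrightarrow>
                   d \<in> {0 ..< real CARD('n)} \<and>
                   (\<forall>i. int (m i) = \<lfloor>(real N + d) * p i\<rfloor>)))))
     \<and> (\<not> q N > q (N + 1) \<longrightarrow>
          \<not> (\<exists>m l. multinomial_mode N p m \<and> l > 0 \<and> (\<forall>i. int (m i) = \<lfloor>l * p i\<rfloor>)))"
proof -
  have qpos: "q N > 0" "q (N + 1) > 0" using decreasing_quotients_pos[OF q p_pos] N by auto
  have "antimono_on {1..} q" using q by (simp add: decreasing_quotients_def)
  then have ge: "q N \<ge> q (N + 1)" using N by (simp add: monotone_on_def)
  have less_iff: "1 / q N < 1 / q (N + 1) \<longleftrightarrow> q N > q (N + 1)"
    using qpos by (simp add: field_simps)
  have l_pos: "l > 0" if "1 / q N \<le> l" for l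
  proof -
    have "1 / q N > 0" using qpos by simp
    then show ?thesis using that by linarith
  qed
  note floor_iff = multinomial_mode_eq_floor_iff[OF N p_pos q]
  have interval: "admissible_interval p m = {1 / q N .. 1 / q (N + 1)}"
    if "multinomial_mode N p m" for m
  proof (rule set_eqI)
    fix l
    show "l \<in> admissible_interval p m \<longleftrightarrow> l \<in> {1 / q N .. 1 / q (N + 1)}"
      unfolding admissible_interval_def admissible_multiplier_def all_conj_distrib
        mem_Collect_eq atLeastAtMost_iff
      using multinomial_mode_multiplier(1,2)[OF N p_pos q that, of l] l_pos[of l] by blast
  qed
  have unique: "(\<exists>!m. multinomial_mode N p m) \<longleftrightarrow> q N > q (N + 1)"
  proof
    assume "\<exists>!m. multinomial_mode N p m"
    then have "q N \<noteq> q (N + 1)" using multinomial_mode_not_unique[OF N p_pos q] by metis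
    then show "q N > q (N + 1)" using ge by simp
  next
    assume "q N > q (N + 1)"
    \<comment> \<open>This multiplier is the same for every mode, so the floor form at this single
      value determines all coordinates of any mode.\<close>
    then have l: "1 / q N \<in> {1 / q N ..< 1 / q (N + 1)}" using less_iff by simp
    have "m = m'" if "multinomial_mode N p m" "multinomial_mode N p m'" for m m'
    proof
      fix i
      have "int (m i) = \<lfloor>1 / q N * p i\<rfloor>" "int (m' i) = \<lfloor>1 / q N * p i\<rfloor>"
        using floor_iff[OF that(1) l_pos[OF order.refl]]
          floor_iff[OF that(2) l_pos[OF order.refl]] l by blast+
      then show "m i = m' i" by linarith
    qed
    then show "\<exists>!m. multinomial_mode N p m" using multinomial_mode_exists[of N p] by blast
  qed
  have interior: "q N > q (N + 1) \<longleftrightarrow> interior (admissible_interval p m) \<noteq> {}"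
    if "multinomial_mode N p m" for m
    using interval[OF that] less_iff by (auto simp: not_le)
  have floor_form: "(\<forall>i. int (m i) = \<lfloor>l * p i\<rfloor>) \<and> (\<Sum>i\<in>UNIV. \<lfloor>l * p i\<rfloor>) = int N
      \<and> (\<forall>d. l = real N + d \<longrightarrow> d \<in> {0 ..< real CARD('n)} \<and>
            (\<forall>i. int (m i) = \<lfloor>(real N + d) * p i\<rfloor>))"
    if mode: "multinomial_mode N p m" and l: "l \<in> {1 / q N ..< 1 / q (N + 1)}" for m l
  proof -
    have "l > 0" using l_pos l by simp
    then have fl: "int (m i) = \<lfloor>l * p i\<rfloor>" for i
      using floor_iff[OF mode] l by blast
    have "(\<Sum>i\<in>UNIV. m i) = N" using mode by (simp add: multinomial_mode_iff)
    then have "(\<Sum>i\<in>UNIV. int (m i)) = int N" by (metis of_nat_sum)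
    then have sum: "(\<Sum>i\<in>UNIV. \<lfloor>l * p i\<rfloor>) = int N" by (simp add: fl)
    \<comment> \<open>Since the \<open>p i\<close> sum to 1, splitting each \<open>l * p i\<close>
      into floor and fractional part shows that \<open>l - N\<close> is a sum of
      \<open>CARD('n)\<close> numbers in [0,1). This gives the range of \<open>d\<close>.\<close>
    have "l = (\<Sum>i\<in>UNIV. l * p i)" using p_sum by (simp flip: sum_distrib_left)
    also have "\<dots> = (\<Sum>i\<in>UNIV. real_of_int \<lfloor>l * p i\<rfloor> + frac (l * p i))"
      by (simp add: frac_def)
    also have "\<dots> = real_of_int (\<Sum>i\<in>UNIV. \<lfloor>l * p i\<rfloor>) + (\<Sum>i\<in>UNIV. frac (l * p i))"
      by (simp add: sum.distrib)
    finally have "l - real N = (\<Sum>i\<in>UNIV. frac (l * p i))" by (simp add: sum)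
    moreover have "\<dots> < (\<Sum>i\<in>(UNIV :: 'n set). 1)"
      by (rule sum_strict_mono) (auto simp: frac_lt_1)
    moreover have "(\<Sum>i\<in>UNIV. frac (l * p i)) \<ge> 0" by (simp add: sum_nonneg)
    ultimately have "l - real N \<in> {0 ..< real CARD('n)}" by simp
    then show ?thesis using fl sum by (metis add_diff_cancel_left')
  qed
  have no_floor_form: "\<not> (\<exists>m l. multinomial_mode N p m \<and> l > 0 \<and> (\<forall>i. int (m i) = \<lfloor>l * p i\<rfloor>))"
    if "\<not> q N > q (N + 1)"
  proof clarify
    fix m l
    assume "multinomial_mode N p m" "l > 0" "\<forall>i. int (m i) = \<lfloor>l * p i\<rfloor>"
    \<comment> \<open>A floor form would put \<open>l\<close> into an interval that is empty
      here.\<close>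
    then have "l \<in> {1 / q N ..< 1 / q (N + 1)}" using floor_iff by blast
    then show False using that less_iff by auto
  qed
  show ?thesis
    using interval unique interior floor_form no_floor_form by blast
qed

end
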